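(* For every prime power $q$, the order $|\widehat{GL(2,q)}|$ of the group of semicharacters of $GL(2,q)$ is divisible by $|GL(2,q)|$.
   Context: A semicharacter of a finite group $G$ is a function $f:G\to\mathbb{C}^{*}$ satisfying $f(ab)=f(a)f(b)$ for all pairs of commuting elements $a,b\in G$. The set $\widehat{G}$ of all semicharacters of $G$ is an abelian group under pointwise multiplication (it is finite whenever $G$ is finite). $GL(2,q)$ is the group of invertible $2\times 2$ matrices over the finite field $\mathbb{F}_q$ with $q$ elements. *)

theory Defs
  imports
    "HOL-Analysis.Determinants"
    "HOL-Algebra.Multiplicative_Group"
    "HOL-Number_Theory.Prime_Powers"
begin

(* Extensional functions (undefined outside the carrier), so that a semicharacter is determined
   by its values on the group and the set of all of them is counted correctly. *)
definition semicharacters :: "('g, 'm) monoid_scheme \<Rightarrow> ('g \<Rightarrow> complex) set" where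
  "semicharacters G =
     {f \<in> carrier G \<rightarrow>\<^sub>E (UNIV - {0}).
        \<forall>a\<in>carrier G. \<forall>b\<in>carrier G.
          a \<otimes>\<^bsub>G\<^esub> b = b \<otimes>\<^bsub>G\<^esub> a \<longrightarrow> f (a \<otimes>\<^bsub>G\<^esub> b) = f a * f b}"

definition semicharacter_group :: "('g, 'm) monoid_scheme \<Rightarrow> ('g \<Rightarrow> complex) monoid" where
  "semicharacter_group G =
     \<lparr>carrier = semicharacters G,
      monoid.mult = (\<lambda>f g. \<lambda>x\<in>carrier G. f x * g x),
      one = (\<lambda>x\<in>carrier G. 1)\<rparr>"

(* GL(n, F), where the field F is the type 'a and n = CARD('n). *)
definition general_linear_group :: "('a::field ^ 'n ^ 'n) monoid" where
  "general_linear_group =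
     \<lparr>carrier = {A. invertible A}, monoid.mult = (**), one = mat 1\<rparr>"

lemma group_general_linear_group: "group (general_linear_group :: ('a::field ^ 'n ^ 'n) monoid)"
proof (rule groupI)
  fix A :: "'a ^ 'n ^ 'n"
  assume "A \<in> carrier general_linear_group"
  then obtain B where "A ** B = mat 1" "B ** A = mat 1"
    by (auto simp: general_linear_group_def invertible_def)
  then show "\<exists>B\<in>carrier general_linear_group.
      B \<otimes>\<^bsub>general_linear_group\<^esub> A = \<one>\<^bsub>general_linear_group\<^esub>"
    by (auto simp: general_linear_group_def invertible_def)
next
  fix A B :: "'a ^ 'n ^ 'n"
  assume "A \<in> carrier general_linear_group" "B \<in> carrier general_linear_group"
  then show "A \<otimes>\<^bsub>general_linear_group\<^esub> B \<in> carrier general_linear_group"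
    by (simp add: general_linear_group_def invertible_det_nz det_mul)
qed (auto simp: general_linear_group_def invertible_det_nz matrix_mul_assoc)

lemma comm_group_semicharacter_group:
  assumes "group G"
  shows "comm_group (semicharacter_group G)"
proof -
  interpret group G by (fact assms)
  show ?thesis
  proof (rule comm_groupI)
    fix f assume f: "f \<in> carrier (semicharacter_group G)"
    let ?g = "\<lambda>x\<in>carrier G. inverse (f x)"
    have "?g \<in> carrier (semicharacter_group G)"
      using f by (auto simp: semicharacter_group_def semicharacters_def PiE_iff)
    moreover have "?g \<otimes>\<^bsub>semicharacter_group G\<^esub> f = \<one>\<^bsub>semicharacter_group G\<^esub>"
      using f by (auto simp: semicharacter_group_def semicharacters_def PiE_iff intro!: restrict_ext)
    ultimately show "\<exists>g\<in>carrier (semicharacter_group G).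
        g \<otimes>\<^bsub>semicharacter_group G\<^esub> f = \<one>\<^bsub>semicharacter_group G\<^esub>"
      by blast
  next
    fix f assume "f \<in> carrier (semicharacter_group G)"
    then show "\<one>\<^bsub>semicharacter_group G\<^esub> \<otimes>\<^bsub>semicharacter_group G\<^esub> f = f"
      by (auto simp: semicharacter_group_def semicharacters_def PiE_iff extensional_def fun_eq_iff)
  qed (auto simp: semicharacter_group_def semicharacters_def PiE_iff mult_ac intro!: restrict_ext)
qed

lemma finite_semicharacter_group:
  assumes "group G" "finite (carrier G)"
  shows "finite (carrier (semicharacter_group G))"
proof -
  interpret group G by (fact assms)
  have pos: "order G > 0"
    using assms(2) order_gt_0_iff_finite by blast
  have "f x ^ order G = 1" if f: "f \<in> semicharacters G" and x: "x \<in> carrier G" for f x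
  proof -
    have mult: "f (a \<otimes>\<^bsub>G\<^esub> b) = f a * f b"
      if "a \<in> carrier G" "b \<in> carrier G" "a \<otimes>\<^bsub>G\<^esub> b = b \<otimes>\<^bsub>G\<^esub> a" for a b
      using f that by (auto simp: semicharacters_def)
    have "f \<one>\<^bsub>G\<^esub> \<noteq> 0"
      using f by (auto simp: semicharacters_def PiE_iff)
    then have one: "f \<one>\<^bsub>G\<^esub> = 1"
      using mult[of "\<one>\<^bsub>G\<^esub>" "\<one>\<^bsub>G\<^esub>"] by simp
    have "f (x [^]\<^bsub>G\<^esub> n) = f x ^ n" for n :: nat
    proof (induction n)
      case (Suc n)
      have "x [^]\<^bsub>G\<^esub> n \<otimes>\<^bsub>G\<^esub> x = x \<otimes>\<^bsub>G\<^esub> x [^]\<^bsub>G\<^esub> n"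
        using x by (metis nat_pow_Suc nat_pow_Suc2)
      then show ?case
        using Suc x mult[of "x [^]\<^bsub>G\<^esub> n" x] by simp
    qed (simp add: one)
    from this[of "order G"] show ?thesis
      using one pow_order_eq_1[OF x] by simp
  qed
  then have "semicharacters G \<subseteq> carrier G \<rightarrow>\<^sub>E {z. z ^ order G = 1}"
    by (auto simp: semicharacters_def PiE_iff extensional_def)
  moreover have "finite (carrier G \<rightarrow>\<^sub>E {z :: complex. z ^ order G = 1})"
    using assms(2) pos by (intro finite_PiE finite_roots_unity) auto
  ultimately show ?thesis
    by (auto simp: semicharacter_group_def intro: finite_subset)
qed

end

theory Submission
  imports Defs
begin

text \<open>
  Let \<open>M\<close> range over the four non-scalar matrices with rows \<open>(0 0 | 0 1)\<close>, \<open>(0 0 | 1 1)\<close>, \<open>(0 0 | 1 0)\<close>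
  and \<open>(0 d | 1 1)\<close>, where \<open>t\<^sup>2 + t = d\<close> has no solution. Commuting is transitive on non-scalar
  \<open>2 \<times> 2\<close> matrices, so the centralizers \<open>A\<^sub>M\<close> are abelian, meet pairwise in the group \<open>Z\<close> of scalar
  matrices, and contain the centralizer of each of their non-scalar elements. Hence arbitrary
  characters of the quotients \<open>A\<^sub>M / Z\<close> glue, with value 1 elsewhere, to a semicharacter. These
  semicharacters form a subgroup of order
  \<open>\<Prod>\<^sub>M |A\<^sub>M / Z| = (q - 1) (q - 1) q (q + 1) = |GL(2,q)|\<close>, and Lagrange's theorem applies.
\<close>

section \<open>Counting characters of a finite abelian group\<close>

text \<open>For an abelian subgroup \<open>H\<close> containing \<open>Z\<close> these are the
  characters of the quotient H/Z, encoded on \<open>H\<close> itself so that no cosets appear. Only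
  the multiplication of \<open>G\<close> enters, so the set stays the same when \<open>G\<close> is
  cut down to a subgroup containing \<open>H\<close>.\<close>

definition characters_over :: "('g, 'm) monoid_scheme \<Rightarrow> 'g set \<Rightarrow> 'g set \<Rightarrow> ('g \<Rightarrow> complex) set" where
  "characters_over G Z H =
     {f \<in> H \<rightarrow>\<^sub>E (UNIV - {0}).
        (\<forall>a\<in>H. \<forall>b\<in>H. f (a \<otimes>\<^bsub>G\<^esub> b) = f a * f b) \<and> (\<forall>z\<in>Z. f z = 1)}"

lemma characters_over_self:
  assumes "\<And>a b. a \<in> Z \<Longrightarrow> b \<in> Z \<Longrightarrow> a \<otimes>\<^bsub>G\<^esub> b \<in> Z"
  shows "characters_over G Z Z = {\<lambda>x\<in>Z. 1}"
  using assms by (auto simp: characters_over_def PiE_iff extensional_def fun_eq_iff)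

section \<open>Adjoining one element to a subgroup of an abelian group\<close>

context comm_group
begin

definition adjoin :: "'a set \<Rightarrow> 'a \<Rightarrow> 'a set" where
  "adjoin K x = {k \<otimes> x [^] i | k (i :: int). k \<in> K}"

lemma subgroup_adjoin:
  assumes K: "subgroup K G" and x: "x \<in> carrier G"
  shows "subgroup (adjoin K x) G"
proof
  interpret K: subgroup K G by (fact K)
  show "adjoin K x \<subseteq> carrier G"
    using x by (auto simp: adjoin_def)
  show "\<one> \<in> adjoin K x"
    unfolding adjoin_def by (rule CollectI, intro exI[of _ \<one>] exI[of _ "0::int"]) auto
  fix a assume "a \<in> adjoin K x"
  then obtain k i where k: "k \<in> K" and a: "a = k \<otimes> x [^] (i::int)" by (auto simp: adjoin_def)
  have "inv a = inv k \<otimes> x [^] (- i)"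
    using k x a by (simp add: inv_mult int_pow_neg)
  then show "inv a \<in> adjoin K x"
    using k unfolding adjoin_def by blast
  fix b assume "b \<in> adjoin K x"
  then obtain l j where l: "l \<in> K" and b: "b = l \<otimes> x [^] (j::int)" by (auto simp: adjoin_def)
  have "a \<otimes> b = (k \<otimes> l) \<otimes> x [^] (i + j)"
    using k x l a b by (simp add: int_pow_mult m_ac)
  then show "a \<otimes> b \<in> adjoin K x"
    using k l unfolding adjoin_def by blast
qed

lemma subset_adjoin:
  assumes K: "subgroup K G" and x: "x \<in> carrier G"
  shows "K \<subseteq> adjoin K x" "x \<in> adjoin K x"
proof -
  interpret K: subgroup K G by (fact K)
  show "K \<subseteq> adjoin K x"
  proof
    fix k assume "k \<in> K"
    then show "k \<in> adjoin K x"
      unfolding adjoin_def by (intro CollectI exI[of _ k] exI[of _ "0::int"]) auto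
  qed
  show "x \<in> adjoin K x"
    unfolding adjoin_def using x by (intro CollectI exI[of _ \<one>] exI[of _ "1::int"]) auto
qed

text \<open>The number \<open>n\<close> is the order of the coset of \<open>x\<close> modulo
  \<open>K\<close>: the least positive exponent taking \<open>x\<close> into \<open>K\<close>, which
  exists because the group order is such an exponent. The remainder of any other such exponent
  modulo \<open>n\<close> contradicts minimality unless it is 0.\<close>

lemma int_pow_mem_subgroup_iff_dvd:
  assumes K: "subgroup K G" and x: "x \<in> carrier G" and fin: "finite (carrier G)"
  obtains n :: nat where "n > 0" "\<And>i::int. x [^] i \<in> K \<longleftrightarrow> int n dvd i"
proof -
  interpret K: subgroup K G by (fact K)
  define n where "n = (LEAST n::nat. n > 0 \<and> x [^] n \<in> K)"
  have "order G > 0 \<and> x [^] order G \<in> K"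
    using x fin by (simp add: pow_order_eq_1 order_gt_0_iff_finite)
  then have n: "n > 0 \<and> x [^] n \<in> K"
    unfolding n_def by (rule LeastI)
  have mult: "x [^] (int n * m) \<in> K" for m
  proof -
    have "x [^] (int n * m) = (x [^] n) [^] m"
      using x by (simp add: int_pow_pow[symmetric] int_pow_int)
    then show ?thesis using n K by (simp add: int_pow_closed subgroup_int_pow_closed)
  qed
  have "x [^] i \<in> K \<longleftrightarrow> int n dvd i" for i :: int
  proof
    assume i: "x [^] i \<in> K"
    have eq: "i mod int n = i + int n * (- (i div int n))"
      by (simp add: minus_div_mult_eq_mod[symmetric] mult.commute)
    have "x [^] (i mod int n) = x [^] i \<otimes> x [^] (int n * (- (i div int n)))"
      unfolding eq by (rule int_pow_mult[OF x])
    also have "\<dots> \<in> K" using i mult by blast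
    finally have "x [^] nat (i mod int n) \<in> K"
      using n by (simp flip: int_pow_int)
    moreover have "nat (i mod int n) < n" using n by (simp add: nat_less_iff)
    ultimately have "nat (i mod int n) = 0"
      using not_less_Least[of "nat (i mod int n)" "\<lambda>n. n > 0 \<and> x [^] n \<in> K"]
      unfolding n_def[symmetric] by auto
    moreover have "i mod int n \<ge> 0" using n by simp
    ultimately have "i mod int n = 0" by linarith
    then show "int n dvd i" by presburger
  qed (use mult in auto)
  with n that show thesis by blast
qed

text \<open>Two representations of an element of \<open>adjoin K x\<close> differ by a power of
  \<open>x\<close> lying in \<open>K\<close>. Both the count of \<open>adjoin K x\<close> and the
  well-definedness of extended characters rest on this.\<close>

lemma mult_int_pow_eqD:
  assumes K: "subgroup K G" and x: "x \<in> carrier G" and kl: "k \<in> K" "l \<in> K"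
    and eq: "k \<otimes> x [^] (i :: int) = l \<otimes> x [^] (j :: int)"
  shows "x [^] (i - j) \<in> K" "l = k \<otimes> x [^] (i - j)"
proof -
  interpret K: subgroup K G by (fact K)
  have l: "l = k \<otimes> x [^] i \<otimes> inv (x [^] j)"
    using kl x by (simp add: eq m_assoc)
  then show "l = k \<otimes> x [^] (i - j)"
    using kl x by (simp add: int_pow_diff m_assoc)
  have "x [^] (i - j) = inv k \<otimes> l"
    using kl x l by (simp add: int_pow_diff m_assoc inv_solve_left)
  then show "x [^] (i - j) \<in> K"
    using kl by simp
qed

text \<open>Reducing the exponent modulo \<open>n\<close>, with the surplus power of
  \<open>x\<close> absorbed into \<open>K\<close>, gives every element a unique normal form with
  exponent in \<open>{0..<int n}\<close>.\<close>

lemma card_adjoin: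
  assumes K: "subgroup K G" and x: "x \<in> carrier G"
    and n: "n > 0" "\<And>i::int. x [^] i \<in> K \<longleftrightarrow> int n dvd i"
  shows "card (adjoin K x) = card K * n"
proof -
  interpret K: subgroup K G by (fact K)
  have "inj_on (\<lambda>(k, i). k \<otimes> x [^] i) (K \<times> {0..<int n})"
  proof (rule inj_onI, clarify)
    fix k l and i j :: int
    assume kl: "k \<in> K" "l \<in> K" and ij: "i \<in> {0..<int n}" "j \<in> {0..<int n}"
      and eq: "k \<otimes> x [^] i = l \<otimes> x [^] j"
    have "int n dvd i - j"
      using mult_int_pow_eqD(1)[OF K x kl eq] n(2) by simp
    moreover have "\<bar>i - j\<bar> < int n" using ij by auto
    ultimately have "i = j" using dvd_imp_le_int[of "i - j" "int n"] by fastforce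
    then show "k = l \<and> i = j" using eq kl x by simp
  qed
  moreover have "(\<lambda>(k, i). k \<otimes> x [^] i) ` (K \<times> {0..<int n}) = adjoin K x"
  proof (intro equalityI subsetI)
    fix y assume "y \<in> adjoin K x"
    then obtain k i where k: "k \<in> K" and y: "y = k \<otimes> x [^] (i::int)" by (auto simp: adjoin_def)
    have "x [^] i = x [^] (int n * (i div int n)) \<otimes> x [^] (i mod int n)"
      using x by (simp flip: int_pow_mult)
    then have "y = (k \<otimes> x [^] (int n * (i div int n))) \<otimes> x [^] (i mod int n)"
      using k x y by (simp add: m_assoc)
    moreover have "k \<otimes> x [^] (int n * (i div int n)) \<in> K" using k n(2) by simp
    moreover have "i mod int n \<in> {0..<int n}" using n(1) by simp
    ultimately show "y \<in> (\<lambda>(k, i). k \<otimes> x [^] i) ` (K \<times> {0..<int n})" by force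
  qed (auto simp: adjoin_def)
  ultimately have "card (adjoin K x) = card (K \<times> {0..<int n})"
    using card_image by fastforce
  then show ?thesis
    by (simp add: card_cartesian_product)
qed

section \<open>Extending characters by one element, and the resulting count\<close>

lemma character_int_pow:
  assumes f: "f \<in> characters_over G Z H" and H: "subgroup H G" and x: "x \<in> H"
  shows "f (x [^] (i :: int)) = f x powi i"
proof -
  interpret H: subgroup H G by (fact H)
  have mult: "f (a \<otimes> b) = f a * f b" if "a \<in> H" "b \<in> H" for a b
    using f that by (auto simp: characters_over_def)
  have nz: "f a \<noteq> 0" if "a \<in> H" for a
    using f that by (auto simp: characters_over_def)
  have one: "f \<one> = 1"
    using mult[of \<one> \<one>] nz[of \<one>] by simp
  have inv: "f (inv a) = inverse (f a)" if "a \<in> H" for a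
    using mult[of "inv a" a] nz[of a] that one by (simp add: field_simps)
  have powH: "x [^] m \<in> H" for m :: nat
    using subgroup_int_pow_closed[OF H x, of "int m"] by (simp add: int_pow_int)
  have nat: "f (x [^] m) = f x ^ m" for m :: nat
  proof (induction m)
    case (Suc m)
    have "x [^] m \<in> H" by (rule powH)
    then show ?case using Suc x mult[of "x [^] m" x] by simp
  next
    case 0 show ?case using one by simp
  qed
  show ?thesis
  proof (cases "i \<ge> 0")
    case True
    then obtain m where "i = int m" using zero_le_imp_eq_int by blast
    then show ?thesis by (simp add: int_pow_int nat)
  next
    case False
    then obtain m where "i = - int m"
      by (metis int_cases2 of_nat_0_le_iff)
    then show ?thesis
      by (simp add: int_pow_neg_int[OF H.mem_carrier[OF x]] inv[OF powH] nat power_int_minus)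
  qed
qed

text \<open>Multiplicativity forces the value \<open>\<psi> k * z powi i\<close> at the product of
  \<open>k\<close> and the \<open>i\<close>-th power of \<open>x\<close>. The condition on
  \<open>z ^ n\<close> is exactly what makes this value independent of the chosen
  representation.\<close>

lemma extend_character:
  assumes K: "subgroup K G" and x: "x \<in> carrier G" and ZK: "Z \<subseteq> K"
    and n: "\<And>i::int. x [^] i \<in> K \<longleftrightarrow> int n dvd i"
    and \<psi>: "\<psi> \<in> characters_over G Z K" and z: "z \<noteq> 0" "z ^ n = \<psi> (x [^] n)"
  obtains f where "f \<in> characters_over G Z (adjoin K x)" "restrict f K = \<psi>" "f x = z"
proof -
  interpret K: subgroup K G by (fact K)
  have \<psi>_mult: "\<psi> (a \<otimes> b) = \<psi> a * \<psi> b" if "a \<in> K" "b \<in> K" for a b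
    using \<psi> that by (auto simp: characters_over_def)
  have \<psi>_nz: "\<psi> a \<noteq> 0" if "a \<in> K" for a
    using \<psi> that by (auto simp: characters_over_def)
  have \<psi>_one: "\<psi> \<one> = 1"
    using \<psi>_mult[of \<one> \<one>] \<psi>_nz[of \<one>] by simp
  have xn: "x [^] n \<in> K"
    using n[of "int n"] by (simp add: int_pow_int)
  have wd: "\<psi> k * z powi i = \<psi> l * z powi j"
    if kl: "k \<in> K" "l \<in> K" and eq: "k \<otimes> x [^] i = l \<otimes> x [^] j" for k l and i j :: int
  proof -
    note d = mult_int_pow_eqD[OF K x kl eq]
    then obtain m where m: "i - j = int n * m"
      using n by (auto elim: dvdE)
    have "x [^] (i - j) = (x [^] n) [^] m"
      unfolding m using x by (simp add: int_pow_pow[symmetric] int_pow_int)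
    then have "\<psi> (x [^] (i - j)) = z powi (i - j)"
      using character_int_pow[OF \<psi> K xn, of m] z(2)
      by (simp add: m power_int_mult)
    then have "\<psi> l = \<psi> k * z powi (i - j)"
      using d \<psi>_mult kl by metis
    then show ?thesis
      using z(1) by (simp add: power_int_diff)
  qed
  \<comment> \<open>The choice is harmless: by \<open>wd\<close> every representation of
    \<open>y\<close> yields the same \<open>v\<close>.\<close>
  define f where "f = (\<lambda>y\<in>adjoin K x. SOME v. \<exists>k\<in>K. \<exists>i::int. y = k \<otimes> x [^] i \<and> v = \<psi> k * z powi i)"
  have f: "f (k \<otimes> x [^] i) = \<psi> k * z powi i" if k: "k \<in> K" for k and i :: int
  proof -
    have mem: "k \<otimes> x [^] i \<in> adjoin K x"
      using k by (auto simp: adjoin_def)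
    have "(SOME v. \<exists>l\<in>K. \<exists>j::int. k \<otimes> x [^] i = l \<otimes> x [^] j \<and> v = \<psi> l * z powi j) = \<psi> k * z powi i"
      by (rule some_equality) (use k wd in metis)+
    then show ?thesis
      unfolding f_def using mem by simp
  qed
  have fK: "f k = \<psi> k" if "k \<in> K" for k
    using f[OF that, of 0] that by simp
  have "f \<in> characters_over G Z (adjoin K x)"
    unfolding characters_over_def
  proof (intro CollectI conjI PiE_I ballI)
    fix a assume "a \<in> adjoin K x"
    then obtain k i where k: "k \<in> K" and a: "a = k \<otimes> x [^] (i::int)" by (auto simp: adjoin_def)
    show "f a \<in> UNIV - {0}"
      using k \<psi>_nz z(1) by (simp add: a f)
    fix b assume "b \<in> adjoin K x"
    then obtain l j where l: "l \<in> K" and b: "b = l \<otimes> x [^] (j::int)" by (auto simp: adjoin_def)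
    have "a \<otimes> b = (k \<otimes> l) \<otimes> x [^] (i + j)"
      using k x l a b by (simp add: int_pow_mult m_ac)
    then show "f (a \<otimes> b) = f a * f b"
      using k l z(1) by (simp add: a b f \<psi>_mult power_int_add)
  next
    fix y assume "y \<in> Z"
    then show "f y = 1"
      using \<psi> ZK fK by (auto simp: characters_over_def)
  qed (simp add: f_def)
  moreover have "restrict f K = \<psi>"
    using \<psi> fK by (auto simp: characters_over_def PiE_iff extensional_def fun_eq_iff)
  moreover have "f x = z"
    using f[of \<one> 1] x \<psi>_one by simp
  ultimately show thesis by (rule that)
qed

text \<open>An extension of \<open>\<psi>\<close> is determined by its value at \<open>x\<close>,
  and the admissible values are the \<open>n\<close>-th roots of the nonzero number
  \<open>\<psi> (x [^] n)\<close>. Hence every character of \<open>K\<close> has exactly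
  \<open>n\<close> extensions.\<close>

lemma bij_betw_characters_adjoin:
  assumes K: "subgroup K G" and x: "x \<in> carrier G" and ZK: "Z \<subseteq> K"
    and n: "n > 0" "\<And>i::int. x [^] i \<in> K \<longleftrightarrow> int n dvd i"
  shows "bij_betw (\<lambda>f. (restrict f K, f x)) (characters_over G Z (adjoin K x))
           (SIGMA \<psi>:characters_over G Z K. {z. z ^ n = \<psi> (x [^] n)})"
proof (rule bij_betw_imageI)
  interpret K: subgroup K G by (fact K)
  interpret L: subgroup "adjoin K x" G by (rule subgroup_adjoin[OF K x])
  note sub = subset_adjoin[OF K x]
  have xn: "x [^] n \<in> K"
    using n(2)[of "int n"] by (simp add: int_pow_int)
  have pow: "f (x [^] (i::int)) = f x powi i" and mem: "x [^] i \<in> adjoin K x"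
    if "f \<in> characters_over G Z (adjoin K x)" for f i
    using character_int_pow[OF that L.subgroup_axioms sub(2)]
      subgroup_int_pow_closed[OF L.subgroup_axioms sub(2)] by auto
  show "inj_on (\<lambda>f. (restrict f K, f x)) (characters_over G Z (adjoin K x))"
  proof (rule inj_onI)
    fix f g assume f: "f \<in> characters_over G Z (adjoin K x)"
      and g: "g \<in> characters_over G Z (adjoin K x)"
      and eq: "(restrict f K, f x) = (restrict g K, g x)"
    show "f = g"
    proof (rule extensionalityI)
      show "f \<in> extensional (adjoin K x)" "g \<in> extensional (adjoin K x)"
        using f g by (auto simp: characters_over_def PiE_iff)
      fix y assume "y \<in> adjoin K x"
      then obtain k i where k: "k \<in> K" and y: "y = k \<otimes> x [^] (i::int)" by (auto simp: adjoin_def)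
      have h: "h y = h k * h x powi i" if h: "h \<in> characters_over G Z (adjoin K x)" for h
        unfolding y pow[OF h, symmetric] using h k sub(1) mem[OF h]
        by (auto simp: characters_over_def)
      have "f k = g k"
        using eq k by (metis Pair_inject restrict_apply')
      then show "f y = g y"
        using h[OF f] h[OF g] eq by simp
    qed
  qed
  show "(\<lambda>f. (restrict f K, f x)) ` characters_over G Z (adjoin K x) =
    (SIGMA \<psi>:characters_over G Z K. {z. z ^ n = \<psi> (x [^] n)})"
  proof (intro equalityI subsetI)
    fix p assume "p \<in> (\<lambda>f. (restrict f K, f x)) ` characters_over G Z (adjoin K x)"
    then obtain f where f: "f \<in> characters_over G Z (adjoin K x)" and p: "p = (restrict f K, f x)"
      by blast
    have "f x ^ n = f (x [^] n)"
      using pow[OF f, of "int n"] by (simp add: int_pow_int)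
    moreover have "restrict f K \<in> characters_over G Z K"
      using f sub(1) ZK by (auto simp: characters_over_def PiE_iff subset_iff)
    ultimately show "p \<in> (SIGMA \<psi>:characters_over G Z K. {z. z ^ n = \<psi> (x [^] n)})"
      using xn by (simp add: p)
  next
    fix p assume "p \<in> (SIGMA \<psi>:characters_over G Z K. {z. z ^ n = \<psi> (x [^] n)})"
    then obtain \<psi> z where \<psi>: "\<psi> \<in> characters_over G Z K" and z: "z ^ n = \<psi> (x [^] n)"
      and p: "p = (\<psi>, z)" by blast
    have "\<psi> (x [^] n) \<noteq> 0"
      using \<psi> xn by (auto simp: characters_over_def)
    then have "z \<noteq> 0"
      using z n(1) by (metis zero_power)
    then obtain f where "f \<in> characters_over G Z (adjoin K x)" "restrict f K = \<psi>" "f x = z"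
      using extend_character[OF K x ZK n(2) \<psi> _ z] by blast
    then show "p \<in> (\<lambda>f. (restrict f K, f x)) ` characters_over G Z (adjoin K x)"
      by (auto simp: p intro!: rev_image_eqI)
  qed
qed

text \<open>Adjoining an element multiplies both the number of characters and the size of the
  subgroup by the same \<open>n\<close>. A largest subgroup for which the formula holds therefore
  cannot be proper.\<close>

lemma card_characters_over:
  assumes fin: "finite (carrier G)" and Z: "subgroup Z G"
  shows "card (characters_over G Z (carrier G)) * card Z = card (carrier G)"
proof -
  \<comment> \<open>Finiteness of the character set is carried along because the cardinality of the
    sigma set below depends on it.\<close>
  define P where "P H \<longleftrightarrow> subgroup H G \<and> Z \<subseteq> H \<and> finite (characters_over G Z H) \<and>
    card (characters_over G Z H) * card Z = card H" for H
  have "P Z"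
    using Z by (auto simp: P_def characters_over_self subgroup.m_closed)
  moreover have "\<forall>H. P H \<longrightarrow> card H < Suc (card (carrier G))"
    using fin by (auto simp: P_def less_Suc_eq_le card_mono dest: subgroup.subset)
  ultimately obtain H where H: "P H" and max: "\<And>L. P L \<Longrightarrow> card L \<le> card H"
    using Lattices_Big.ex_has_greatest_nat[of P Z card] by blast
  then have sub: "subgroup H G" "Z \<subseteq> H" by (auto simp: P_def)
  have "H = carrier G"
  proof (rule ccontr)
    assume "H \<noteq> carrier G"
    then obtain x where x: "x \<in> carrier G" "x \<notin> H"
      using subgroup.subset[OF sub(1)] by blast
    obtain n where n: "n > 0" "\<And>i::int. x [^] i \<in> H \<longleftrightarrow> int n dvd i"
      using int_pow_mem_subgroup_iff_dvd[OF sub(1) x(1) fin] by metis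
    let ?S = "SIGMA \<psi>:characters_over G Z H. {z. z ^ n = \<psi> (x [^] n)}"
    have xn: "x [^] n \<in> H"
      using n(2)[of "int n"] by (simp add: int_pow_int)
    have roots: "card {z. z ^ n = \<psi> (x [^] n)} = n" "finite {z. z ^ n = \<psi> (x [^] n)}"
      if "\<psi> \<in> characters_over G Z H" for \<psi>
    proof -
      have "\<psi> (x [^] n) \<noteq> 0"
        using that xn by (auto simp: characters_over_def)
      then show "card {z. z ^ n = \<psi> (x [^] n)} = n" "finite {z. z ^ n = \<psi> (x [^] n)}"
        using card_nth_roots[of "\<psi> (x [^] n)" n] finite_nth_roots[of n "\<psi> (x [^] n)"] n(1) by auto
    qed
    note bij = bij_betw_characters_adjoin[OF sub(1) x(1) sub(2) n]
    have "finite ?S" "card ?S = card (characters_over G Z H) * n"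
      using H roots by (auto simp: P_def)
    then have "P (adjoin H x)"
      using H bij_betw_finite[OF bij] bij_betw_same_card[OF bij] subgroup_adjoin[OF sub(1) x(1)]
        subset_adjoin[OF sub(1) x(1)] card_adjoin[OF sub(1) x(1) n]
      by (auto simp: P_def)
    from max[OF this] have "card (adjoin H x) \<le> card H" .
    moreover have "finite (adjoin H x)"
      using subgroup_adjoin[OF sub(1) x(1)] fin by (meson finite_subset subgroup.subset)
    ultimately have "adjoin H x = H"
      using card_seteq subset_adjoin(1)[OF sub(1) x(1)] by metis
    then show False
      using x subset_adjoin(2)[OF sub(1) x(1)] by simp
  qed
  then show ?thesis using H by (simp add: P_def)
qed

end

section \<open>Gluing characters of abelian subgroups\<close>

text \<open>The sets \<open>A i - Z\<close> are disjoint, and a commuting pair that meets one of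
  them lies wholly in that \<open>A i\<close>. Characters of the different \<open>A i\<close>
  trivial on \<open>Z\<close> can thus be prescribed independently, and the glued functions form a
  subgroup to which Lagrange's theorem applies.\<close>

lemma (in group) prod_index_dvd_order_semicharacter_group:
  assumes fin: "finite (carrier G)" "finite I"
    and Z: "subgroup Z G"
    and A: "\<And>i. i \<in> I \<Longrightarrow> subgroup (A i) G" "\<And>i. i \<in> I \<Longrightarrow> Z \<subseteq> A i"
    and comm: "\<And>i a b. i \<in> I \<Longrightarrow> a \<in> A i \<Longrightarrow> b \<in> A i \<Longrightarrow> a \<otimes> b = b \<otimes> a"
    and centralizer: "\<And>i a b. i \<in> I \<Longrightarrow> a \<in> A i - Z \<Longrightarrow> b \<in> carrier G \<Longrightarrow> a \<otimes> b = b \<otimes> a \<Longrightarrow> b \<in> A i"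
    and disj: "\<And>i j. i \<in> I \<Longrightarrow> j \<in> I \<Longrightarrow> i \<noteq> j \<Longrightarrow> A i \<inter> A j \<subseteq> Z"
  shows "(\<Prod>i\<in>I. card (A i) div card Z) dvd order (semicharacter_group G)"
proof -
  interpret C: comm_group "semicharacter_group G"
    by (rule comm_group_semicharacter_group) (rule is_group)
  define U where "U = (\<Union>i\<in>I. A i - Z)"
  \<comment> \<open>The set \<open>U\<close> is where members of \<open>S\<close> may differ from 1.
    Since \<open>U\<close> avoids \<open>Z\<close>, they are trivial on \<open>Z\<close>.\<close>
  define S where "S = {f \<in> semicharacters G. \<forall>x\<in>carrier G - U. f x = 1}"
  have A_carrier: "x \<in> carrier G" if "i \<in> I" "x \<in> A i" for i x
    using A(1)[OF that(1)] that(2) by (rule subgroup.mem_carrier)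
  have Z_not_U: "x \<in> carrier G - U" if "x \<in> Z" for x
    using that subgroup.mem_carrier[OF Z that] by (auto simp: U_def)
  have "subgroup S (semicharacter_group G)"
  proof
    show "S \<subseteq> carrier (semicharacter_group G)"
      by (auto simp: S_def semicharacter_group_def)
    show "\<one>\<^bsub>semicharacter_group G\<^esub> \<in> S"
      using C.one_closed by (auto simp: S_def semicharacter_group_def)
    fix f assume f: "f \<in> S"
    define g where "g = (\<lambda>x\<in>carrier G. inverse (f x))"
    have g: "g \<in> S"
      using f by (auto simp: g_def S_def semicharacters_def PiE_iff)
    moreover have "g \<otimes>\<^bsub>semicharacter_group G\<^esub> f = \<one>\<^bsub>semicharacter_group G\<^esub>"
      using f by (auto simp: g_def S_def semicharacter_group_def semicharacters_def PiE_iff intro!: restrict_ext)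
    ultimately show "inv\<^bsub>semicharacter_group G\<^esub> f \<in> S"
      using C.inv_equality f by (auto simp: S_def semicharacter_group_def)
    fix h assume h: "h \<in> S"
    show "f \<otimes>\<^bsub>semicharacter_group G\<^esub> h \<in> S"
      using f h by (auto simp: S_def semicharacter_group_def semicharacters_def PiE_iff)
  qed
  then have "card S dvd order (semicharacter_group G)"
    using C.lagrange by (metis dvd_triv_right)
  moreover have "card S = (\<Prod>i\<in>I. card (characters_over G Z (A i)))"
  proof -
    \<comment> \<open>Restricting to all \<open>A i\<close> at once loses nothing on
      \<open>S\<close>, since its members equal 1 off \<open>U\<close>. This identifies
      \<open>S\<close> with the product of the character sets.\<close>
    define r where "r f = (\<lambda>i\<in>I. restrict f (A i))" for f :: "'a \<Rightarrow> complex"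
    have "inj_on r S"
    proof (rule inj_onI)
      fix f g assume fg: "f \<in> S" "g \<in> S" and eq: "r f = r g"
      show "f = g"
      proof (rule extensionalityI)
        show "f \<in> extensional (carrier G)" "g \<in> extensional (carrier G)"
          using fg by (auto simp: S_def semicharacters_def PiE_iff)
        fix x assume x: "x \<in> carrier G"
        show "f x = g x"
        proof (cases "x \<in> U")
          case True
          then obtain i where i: "i \<in> I" "x \<in> A i" by (auto simp: U_def)
          then have "r f i x = f x" "r g i x = g x" by (auto simp: r_def)
          then show ?thesis using eq by simp
        next
          case False
          then show ?thesis using fg x by (auto simp: S_def)
        qed
      qed
    qed
    moreover have "r ` S = (\<Pi>\<^sub>E i\<in>I. characters_over G Z (A i))"
    proof (intro equalityI subsetI)
      fix c assume "c \<in> r ` S"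
      then obtain f where f: "f \<in> S" and c: "c = r f" by blast
      have "restrict f (A i) \<in> characters_over G Z (A i)" if i: "i \<in> I" for i
        unfolding characters_over_def
      proof (intro CollectI conjI PiE_I ballI)
        fix a assume a: "a \<in> A i"
        show "restrict f (A i) a \<in> UNIV - {0}"
          using f a A_carrier[OF i a] by (auto simp: S_def semicharacters_def PiE_iff)
        fix b assume b: "b \<in> A i"
        show "restrict f (A i) (a \<otimes> b) = restrict f (A i) a * restrict f (A i) b"
          using f a b A_carrier[OF i] comm[OF i a b] subgroup.m_closed[OF A(1)[OF i] a b]
          by (auto simp: S_def semicharacters_def)
      next
        fix z assume "z \<in> Z"
        then show "restrict f (A i) z = 1"
          using f A(2)[OF i] Z_not_U by (auto simp: S_def)
      qed simp
      then show "c \<in> (\<Pi>\<^sub>E i\<in>I. characters_over G Z (A i))"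
        by (auto simp: c r_def)
    next
      fix c assume c: "c \<in> (\<Pi>\<^sub>E i\<in>I. characters_over G Z (A i))"
      \<comment> \<open>On \<open>U\<close> the index is unique by \<open>disj\<close>. A point of
        \<open>Z\<close> may lie in several \<open>A i\<close>, but there the default 1 agrees with
        every \<open>c i\<close>.\<close>
      define f where "f = (\<lambda>x\<in>carrier G. if x \<in> U then c (THE i. i \<in> I \<and> x \<in> A i) x else 1)"
      have f_ext: "f \<in> extensional (carrier G)"
        by (simp add: f_def)
      have ci: "c i \<in> characters_over G Z (A i)" if "i \<in> I" for i
        using c that by auto
      have f: "f x = c i x" if i: "i \<in> I" "x \<in> A i" for i x
      proof (cases "x \<in> Z")
        case True
        then show ?thesis
          using Z_not_U[OF True] ci[OF i(1)] by (auto simp: f_def characters_over_def)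
      next
        case False
        then have "(THE i. i \<in> I \<and> x \<in> A i) = i"
          using i disj by (intro the_equality) auto
        moreover have "x \<in> U"
          using False i by (auto simp: U_def)
        ultimately show ?thesis
          using A_carrier[OF i] by (simp add: f_def)
      qed
      have f1: "f x = 1" if "x \<in> carrier G" "x \<notin> U" for x
        using that by (simp add: f_def)
      have mult: "f (a \<otimes> b) = f a * f b"
        if ab: "a \<in> carrier G" "b \<in> carrier G" "a \<otimes> b = b \<otimes> a" for a b
      proof -
        have both: ?thesis if i: "i \<in> I" "a \<in> A i" "b \<in> A i" for i
          using f[OF i(1)] i ci[OF i(1)] subgroup.m_closed[OF A(1)[OF i(1)] i(2,3)]
          by (simp add: characters_over_def)
        \<comment> \<open>If \<open>a\<close>, \<open>b\<close> or their product lies in some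
          \<open>A i - Z\<close>, then all three lie in \<open>A i\<close>, because each commutes
          with the other two; there \<open>f\<close> is the character \<open>c i\<close>. Otherwise
          all three values are 1.\<close>
        consider "a \<in> U" | "b \<in> U" | "a \<otimes> b \<in> U" | "a \<notin> U" "b \<notin> U" "a \<otimes> b \<notin> U" by blast
        then show ?thesis
        proof cases
          case 1
          then show ?thesis using both centralizer ab by (auto simp: U_def)
        next
          case 2
          then show ?thesis using both centralizer[of _ b a] ab by (auto simp: U_def)
        next
          case 3
          then obtain i where i: "i \<in> I" "a \<otimes> b \<in> A i - Z" by (auto simp: U_def)
          have "a \<in> A i"
            using centralizer[OF i ab(1)] ab by (metis m_assoc)
          moreover have "b \<in> A i"
            using centralizer[OF i ab(2)] ab by (metis m_assoc)
          ultimately show ?thesis using both i by blast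
        qed (use f1 ab in auto)
      qed
      have "f a \<noteq> 0" if a: "a \<in> carrier G" for a
      proof (cases "a \<in> U")
        case True
        then obtain i where "i \<in> I" "a \<in> A i" by (auto simp: U_def)
        then show ?thesis using f ci by (force simp: characters_over_def)
      qed (use f1 a in simp)
      then have "f \<in> S"
        using mult f1 f_ext by (auto simp: S_def semicharacters_def PiE_iff)
      moreover have "r f = c"
      proof (rule extensionalityI)
        show "c \<in> extensional I" using c by (auto simp: PiE_iff)
        fix i assume i: "i \<in> I"
        show "r f i = c i"
        proof (rule extensionalityI)
          show "c i \<in> extensional (A i)"
            using ci[OF i] by (auto simp: characters_over_def PiE_iff)
        qed (use i f in \<open>auto simp: r_def\<close>)
      qed (simp add: r_def)
      ultimately show "c \<in> r ` S" by blast
    qed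
    ultimately have "card S = card (\<Pi>\<^sub>E i\<in>I. characters_over G Z (A i))"
      using card_image by metis
    then show ?thesis by (simp add: card_PiE fin)
  qed
  moreover have "card (characters_over G Z (A i)) = card (A i) div card Z" if i: "i \<in> I" for i
  proof -
    \<comment> \<open>The count is applied to \<open>A i\<close> as an abelian group of its own; the
      character set is unaffected by this change of carrier.\<close>
    interpret Ai: comm_group "G\<lparr>carrier := A i\<rparr>"
      using subgroup.subgroup_is_group[OF A(1)[OF i] is_group] comm[OF i]
      by (intro group.group_comm_groupI) auto
    have "subgroup Z (G\<lparr>carrier := A i\<rparr>)"
      using subgroup_incl[OF Z A(1)[OF i] A(2)[OF i]] .
    moreover have "finite (A i)"
      using A_carrier[OF i] fin(1) by (meson finite_subset subsetI)
    ultimately have "card (characters_over G Z (A i)) * card Z = card (A i)"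
      using Ai.card_characters_over[of Z] by (simp add: characters_over_def)
    moreover have "card Z > 0"
      using subgroup.finite_imp_card_positive[OF Z fin(1)] .
    ultimately show ?thesis by (metis nonzero_mult_div_cancel_right neq0_conv)
  qed
  ultimately show ?thesis by simp
qed

section \<open>Centralizers in GL(2,q)\<close>

text \<open>The matrix \<open>M\<close> may be singular, as three of the four matrices used later
  are, so this is not always the centralizer of a group element.\<close>

definition gl_centralizer :: "'a::field ^ 'n ^ 'n \<Rightarrow> ('a ^ 'n ^ 'n) set" where
  "gl_centralizer M = {X. invertible X \<and> X ** M = M ** X}"

lemma subgroup_gl_centralizer:
  "subgroup (gl_centralizer M) (general_linear_group :: ('a::field ^ 'n ^ 'n) monoid)"
proof -
  interpret group "general_linear_group :: ('a ^ 'n ^ 'n) monoid"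
    by (rule group_general_linear_group)
  show ?thesis
  proof
    show "gl_centralizer M \<subseteq> carrier general_linear_group"
      by (auto simp: gl_centralizer_def general_linear_group_def)
    show "\<one>\<^bsub>general_linear_group\<^esub> \<in> gl_centralizer M"
      using one_closed by (auto simp: gl_centralizer_def general_linear_group_def)
    fix X assume X: "X \<in> gl_centralizer M"
    then have Xc: "X \<in> carrier general_linear_group"
      by (auto simp: gl_centralizer_def general_linear_group_def)
    define Y where "Y = inv\<^bsub>general_linear_group\<^esub> X"
    have Y: "Y \<in> carrier general_linear_group" "Y ** X = mat 1" "X ** Y = mat 1"
      using inv_closed[OF Xc] l_inv[OF Xc] r_inv[OF Xc]
      by (auto simp: Y_def general_linear_group_def)
    have "Y ** M = Y ** (M ** X) ** Y"
      by (simp add: Y(3) flip: matrix_mul_assoc)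
    also have "M ** X = X ** M"
      using X by (simp add: gl_centralizer_def)
    finally have "Y ** M = M ** Y"
      by (simp add: Y(2) matrix_mul_assoc)
    then show "inv\<^bsub>general_linear_group\<^esub> X \<in> gl_centralizer M"
      using Y(1) by (auto simp: gl_centralizer_def general_linear_group_def Y_def)
    fix V assume V: "V \<in> gl_centralizer M"
    then have Vc: "V \<in> carrier general_linear_group"
      by (auto simp: gl_centralizer_def general_linear_group_def)
    have "X ** V ** M = X ** (V ** M)"
      by (simp only: matrix_mul_assoc)
    also have "V ** M = M ** V"
      using V by (simp add: gl_centralizer_def)
    also have "X ** (M ** V) = X ** M ** V"
      by (simp only: matrix_mul_assoc)
    also have "X ** M = M ** X"
      using X by (simp add: gl_centralizer_def)
    also have "M ** X ** V = M ** (X ** V)"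
      by (simp only: matrix_mul_assoc)
    finally show "X \<otimes>\<^bsub>general_linear_group\<^esub> V \<in> gl_centralizer M"
      using m_closed[OF Xc Vc] by (simp add: gl_centralizer_def general_linear_group_def)
  qed
qed

section \<open>Two-by-two matrices and transitivity of commuting\<close>

definition mat2 :: "'a \<Rightarrow> 'a \<Rightarrow> 'a \<Rightarrow> 'a \<Rightarrow> 'a::zero ^ 2 ^ 2" where
  "mat2 a b c d = vector [vector [a, b], vector [c, d]]"

lemma mat2_cases [cases type]: obtains a b c d where "X = mat2 a b c d"
proof
  show "X = mat2 (X $ 1 $ 1) (X $ 1 $ 2) (X $ 2 $ 1) (X $ 2 $ 2)"
    by (simp add: mat2_def vec_eq_iff forall_2)
qed

lemma mat2_eq_iff [simp]:
  "mat2 a b c d = mat2 a' b' c' d' \<longleftrightarrow> a = a' \<and> b = b' \<and> c = c' \<and> d = d'"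
  by (auto simp: mat2_def vec_eq_iff forall_2)

lemma mat2_mult [simp]:
  "mat2 a b c d ** mat2 a' b' c' d' =
    mat2 (a * a' + b * c') (a * b' + b * d') (c * a' + d * c') (c * b' + d * d')"
  for a :: "'a::semiring_1"
  by (simp add: mat2_def vec_eq_iff forall_2 matrix_matrix_mult_def sum_2)

lemma invertible_mat2: "invertible (mat2 a b c d) \<longleftrightarrow> a * d \<noteq> b * c" for a :: "'a::field"
  by (simp add: invertible_det_nz det_2 mat2_def)

definition scalar_mat2 :: "('a::zero ^ 2 ^ 2) set" where
  "scalar_mat2 = range (\<lambda>a. mat2 a 0 0 a)"

lemma mat2_in_scalar_iff: "mat2 a b c d \<in> scalar_mat2 \<longleftrightarrow> b = 0 \<and> c = 0 \<and> a = d"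
  by (auto simp: scalar_mat2_def)

lemma scalar_mat2_commute: "X \<in> scalar_mat2 \<Longrightarrow> X ** M = M ** X" for X :: "'a::field ^ 2 ^ 2"
  by (cases X; cases M) (auto simp: scalar_mat2_def mult.commute)

text \<open>Commuting means that the vectors \<open>(y, z, w - x)\<close> and
  \<open>(y', z', w' - x')\<close> are parallel, expressed by their vanishing 2 x 2 minors. The two
  diagonal entries of the matrix equation give the same minor.\<close>

lemma mat2_commute_iff:
  fixes x :: "'a::field"
  shows "mat2 x y z w ** mat2 x' y' z' w' = mat2 x' y' z' w' ** mat2 x y z w \<longleftrightarrow>
    y * z' = y' * z \<and> y * (w' - x') = y' * (w - x) \<and> z * (w' - x') = z' * (w - x)"
proof -
  have eq_iff: "p = q \<longleftrightarrow> r = s" if "p - q = r - s" for p q r s :: 'a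
    using that by (metis eq_iff_diff_eq_0)
  have e1: "x * x' + y * z' = x' * x + y' * z \<longleftrightarrow> y * z' = y' * z"
    by (rule eq_iff) (simp add: mult.commute)
  have e2: "x * y' + y * w' = x' * y + y' * w \<longleftrightarrow> y * (w' - x') = y' * (w - x)"
    by (rule eq_iff) (simp add: algebra_simps)
  have e3: "z * x' + w * z' = z' * x + w' * z \<longleftrightarrow> z' * (w - x) = z * (w' - x')"
    by (rule eq_iff) (simp add: algebra_simps)
  have e4: "z * y' + w * w' = z' * y + w' * w \<longleftrightarrow> y' * z = y * z'"
    by (rule eq_iff) (simp add: mult.commute)
  show ?thesis
    unfolding mat2_mult mat2_eq_iff e1 e2 e3 e4 by metis
qed

text \<open>Two vectors parallel to the nonzero vector \<open>(a, b, c)\<close> are multiples of it,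
  hence parallel to each other.\<close>

lemma parallel_trans:
  fixes a :: "'a::field"
  assumes "a \<noteq> 0 \<or> b \<noteq> 0 \<or> c \<noteq> 0"
    and 1: "x * b = a * y" "x * c = a * z" "y * c = b * z"
    and 2: "x' * b = a * y'" "x' * c = a * z'" "y' * c = b * z'"
  shows "x * y' = x' * y \<and> x * z' = x' * z \<and> y * z' = y' * z"
  using assms(1)
proof (elim disjE)
  assume "a \<noteq> 0"
  then have "y = x * b / a" "z = x * c / a" "y' = x' * b / a" "z' = x' * c / a"
    using 1 2 by (metis nonzero_mult_div_cancel_left nonzero_mult_div_cancel_right)+
  then show ?thesis by simp
next
  assume "b \<noteq> 0"
  then have "x = a * y / b" "z = y * c / b" "x' = a * y' / b" "z' = y' * c / b"
    using 1 2 by (metis nonzero_mult_div_cancel_left nonzero_mult_div_cancel_right)+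
  then show ?thesis by simp
next
  assume "c \<noteq> 0"
  then have "x = a * z / c" "y = b * z / c" "x' = a * z' / c" "y' = b * z' / c"
    using 1 2 by (metis nonzero_mult_div_cancel_left nonzero_mult_div_cancel_right)+
  then show ?thesis by simp
qed

text \<open>The vector attached to \<open>M\<close> by \<open>mat2_commute_iff\<close> vanishes only
  for scalar \<open>M\<close>, so transitivity of parallelism applies.\<close>

lemma mat2_commute_trans:
  fixes M :: "'a::field ^ 2 ^ 2"
  assumes "M \<notin> scalar_mat2" "X ** M = M ** X" "Y ** M = M ** Y"
  shows "X ** Y = Y ** X"
proof -
  obtain a b c d where M: "M = mat2 a b c d" by (cases M)
  obtain x y z w where X: "X = mat2 x y z w" by (cases X)
  obtain x' y' z' w' where Y: "Y = mat2 x' y' z' w'" by (cases Y)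
  have "b \<noteq> 0 \<or> c \<noteq> 0 \<or> d - a \<noteq> 0"
    using assms(1) by (auto simp: M mat2_in_scalar_iff)
  moreover from assms(2) have "y * c = b * z" "y * (d - a) = b * (w - x)" "z * (d - a) = c * (w - x)"
    unfolding M X mat2_commute_iff by blast+
  moreover from assms(3) have "y' * c = b * z'" "y' * (d - a) = b * (w' - x')" "z' * (d - a) = c * (w' - x')"
    unfolding M Y mat2_commute_iff by blast+
  ultimately show ?thesis
    unfolding X Y mat2_commute_iff by (rule parallel_trans)
qed

section \<open>Orders of GL(2,q) and of the four centralizers\<close>

lemma sum_if_zero:
  fixes k l :: nat
  shows "(\<Sum>a\<in>(UNIV :: 'a::{zero,finite} set). if a = 0 then k else l) = k + (CARD('a) - 1) * l"
  by (subst sum.remove[of _ 0]) (simp_all add: card_Diff_singleton)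

lemma card_mult_neq:
  fixes a e :: "'a::{field,finite}"
  shows "card {d. a * d \<noteq> e} = (if a = 0 then if e = 0 then 0 else CARD('a) else CARD('a) - 1)"
proof (cases "a = 0")
  case False
  then have "{d. a * d \<noteq> e} = UNIV - {e / a}"
    by (auto simp: field_simps)
  then show ?thesis using False by (simp add: card_Diff_singleton)
qed auto

text \<open>The entry \<open>d\<close> is chosen last: for fixed \<open>a\<close>, \<open>b\<close>,
  \<open>c\<close> the determinant condition reads \<open>a * d \<noteq> e\<close> with
  \<open>e = b * c\<close>, and \<open>card_mult_neq\<close> counts its solutions.\<close>

lemma order_GL2:
  "order (general_linear_group :: ('a::{field,finite} ^ 2 ^ 2) monoid) =
     CARD('a) * (CARD('a) - 1) ^ 2 * (CARD('a) + 1)"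
proof -
  let ?T = "SIGMA a:(UNIV :: 'a set). SIGMA b:(UNIV :: 'a set). SIGMA c:(UNIV :: 'a set). {d. a * d \<noteq> b * c}"
  have "bij_betw (\<lambda>(a, b, c, d). mat2 a b c d) ?T {X. invertible X}"
  proof (rule bij_betw_imageI)
    show "(\<lambda>(a, b, c, d). mat2 a b c d) ` ?T = {X. invertible X}"
    proof (intro equalityI subsetI)
      fix X :: "'a ^ 2 ^ 2" assume "X \<in> {X. invertible X}"
      then show "X \<in> (\<lambda>(a, b, c, d). mat2 a b c d) ` ?T"
        by (cases X) (force simp: invertible_mat2)
    qed (auto simp: invertible_mat2)
  qed (auto simp: inj_on_def)
  then have "order (general_linear_group :: ('a ^ 2 ^ 2) monoid) = card ?T"
    by (simp add: order_def general_linear_group_def bij_betw_same_card)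
  also have "\<dots> = (\<Sum>a\<in>(UNIV::'a set). \<Sum>b\<in>(UNIV::'a set). \<Sum>c\<in>(UNIV::'a set).
      if a = 0 then if b = 0 then 0 else if c = 0 then 0 else CARD('a) else CARD('a) - 1)"
    by (simp add: card_mult_neq cong: if_cong) (intro sum.cong refl, auto)
  also have "\<dots> = (\<Sum>a\<in>(UNIV::'a set). if a = 0 then (CARD('a) - 1) * ((CARD('a) - 1) * CARD('a))
      else CARD('a) * (CARD('a) * (CARD('a) - 1)))"
  proof (intro sum.cong refl)
    fix a :: 'a
    have "(\<Sum>b\<in>(UNIV::'a set). \<Sum>c\<in>(UNIV::'a set). if b = 0 then 0 else if c = 0 then 0 else CARD('a)) =
      (\<Sum>b\<in>(UNIV::'a set). if b = 0 then 0 else (CARD('a) - 1) * CARD('a))"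
      by (intro sum.cong refl) (simp add: sum_if_zero)
    then show "(\<Sum>b\<in>(UNIV::'a set). \<Sum>c\<in>(UNIV::'a set).
      if a = 0 then if b = 0 then 0 else if c = 0 then 0 else CARD('a) else CARD('a) - 1) =
      (if a = 0 then (CARD('a) - 1) * ((CARD('a) - 1) * CARD('a)) else CARD('a) * (CARD('a) * (CARD('a) - 1)))"
      by (simp add: sum_if_zero)
  qed
  also have "\<dots> = CARD('a) * (CARD('a) - 1) ^ 2 * (CARD('a) + 1)"
  proof -
    obtain n where "CARD('a) = Suc n"
      using not0_implies_Suc[of "CARD('a)"] by auto
    then show ?thesis
      by (simp add: sum_if_zero power2_eq_square algebra_simps)
  qed
  finally show ?thesis .
qed

lemma mat2_in_gl_centralizer_iff:
  fixes x :: "'a::field"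
  shows "mat2 x y z w \<in> gl_centralizer (mat2 a b c d) \<longleftrightarrow>
    x * w \<noteq> y * z \<and> y * c = b * z \<and> y * (d - a) = b * (w - x) \<and> z * (d - a) = c * (w - x)"
  by (simp only: gl_centralizer_def mem_Collect_eq invertible_mat2 mat2_commute_iff)

text \<open>Here M = \<open>mat2 0 d 1 s\<close> is the companion matrix of t^2 - s t - d. Its
  commutant consists of the polynomials x + z M, and the inequality is the nonvanishing of the
  determinant.\<close>

lemma mat2_in_companion_centralizer_iff:
  fixes x :: "'a::field"
  shows "mat2 x y z w \<in> gl_centralizer (mat2 0 d 1 s) \<longleftrightarrow>
    y = z * d \<and> w = x + z * s \<and> x * (x + z * s) \<noteq> z * z * d"
proof -
  have "y * 1 = d * z \<longleftrightarrow> y = z * d" "z * (s - 0) = 1 * (w - x) \<longleftrightarrow> w = x + z * s"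
    by (auto simp: mult.commute)
  moreover have "y * (s - 0) = d * (w - x)" "x * w \<noteq> y * z \<longleftrightarrow> x * (x + z * s) \<noteq> z * z * d"
    if "y = z * d" "w = x + z * s"
    unfolding that by (simp_all add: mult_ac)
  ultimately show ?thesis
    unfolding mat2_in_gl_centralizer_iff by blast
qed

lemma card_companion_centralizer:
  fixes d s :: "'a::{field,finite}"
  shows "card (gl_centralizer (mat2 0 d 1 s)) = card {(a, b). a * (a + b * s) \<noteq> b * b * d}"
proof -
  have "gl_centralizer (mat2 0 d 1 s) =
    (\<lambda>(a, b). mat2 a (b * d) b (a + b * s)) ` {(a, b). a * (a + b * s) \<noteq> b * b * d}"
  proof (rule Set.set_eqI)
    fix X :: "'a ^ 2 ^ 2"
    obtain x y z w where "X = mat2 x y z w" by (cases X)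
    then show "X \<in> gl_centralizer (mat2 0 d 1 s) \<longleftrightarrow>
      X \<in> (\<lambda>(a, b). mat2 a (b * d) b (a + b * s)) ` {(a, b). a * (a + b * s) \<noteq> b * b * d}"
      by (simp only: mat2_in_companion_centralizer_iff) auto
  qed
  moreover have "inj_on (\<lambda>(a, b). mat2 a (b * d) b (a + b * s)) S" for S
    by (auto simp: inj_on_def)
  ultimately show ?thesis by (simp add: card_image)
qed

text \<open>Both matrices have eigenvalues 0 and 1, so both centralizers are split tori. The second
  matrix is the companion matrix of t (t - 1).\<close>

lemma card_split_centralizers:
  "card (gl_centralizer (mat2 0 0 0 1 :: 'a::{field,finite} ^ 2 ^ 2)) = (CARD('a) - 1) ^ 2"
  "card (gl_centralizer (mat2 0 0 1 1 :: 'a::{field,finite} ^ 2 ^ 2)) = (CARD('a) - 1) ^ 2"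
proof -
  have "gl_centralizer (mat2 0 0 0 1 :: 'a ^ 2 ^ 2) = (\<lambda>(a, d). mat2 a 0 0 d) ` ((UNIV - {0}) \<times> (UNIV - {0}))"
  proof (rule Set.set_eqI)
    fix X :: "'a ^ 2 ^ 2"
    obtain x y z w where "X = mat2 x y z w" by (cases X)
    then show "X \<in> gl_centralizer (mat2 0 0 0 1) \<longleftrightarrow>
      X \<in> (\<lambda>(a, d). mat2 a 0 0 d) ` ((UNIV - {0}) \<times> (UNIV - {0}))"
      by (simp only: mat2_in_gl_centralizer_iff) auto
  qed
  then show "card (gl_centralizer (mat2 0 0 0 1 :: 'a ^ 2 ^ 2)) = (CARD('a) - 1) ^ 2"
    by (simp add: card_image inj_on_def card_cartesian_product card_Diff_singleton power2_eq_square)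
  have "{(a, b::'a). a * (a + b) \<noteq> 0} = (SIGMA a:UNIV - {0}. UNIV - {- a})"
    by (auto simp: add_eq_0_iff)
  then show "card (gl_centralizer (mat2 0 0 1 1 :: 'a ^ 2 ^ 2)) = (CARD('a) - 1) ^ 2"
    by (simp add: card_companion_centralizer card_Diff_singleton power2_eq_square)
qed

text \<open>The matrix is nilpotent, so a + b M is invertible exactly when \<open>a\<close> is
  nonzero, with \<open>b\<close> free.\<close>

lemma card_unipotent_centralizer:
  "card (gl_centralizer (mat2 0 0 1 0 :: 'a::{field,finite} ^ 2 ^ 2)) = CARD('a) * (CARD('a) - 1)"
proof -
  have "{(a :: 'a, b :: 'a). a * a \<noteq> 0} = (UNIV - {0}) \<times> UNIV"
    by auto
  then show ?thesis
    by (simp add: card_companion_centralizer card_Diff_singleton card_cartesian_product)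
qed

text \<open>The hypothesis, with t replaced by -t, says that t^2 - t - d has no root. So the
  matrices a + b M form a field with q^2 elements, and the centralizer is its multiplicative
  group.\<close>

lemma card_nonsplit_centralizer:
  fixes d :: "'a::{field,finite}"
  assumes "\<And>t. t * t + t \<noteq> d"
  shows "card (gl_centralizer (mat2 0 d 1 1)) = CARD('a) ^ 2 - 1"
proof -
  have "a = 0 \<and> b = 0" if eq: "a * (a + b) = b * b * d" for a b
  proof (rule ccontr)
    assume "\<not> (a = 0 \<and> b = 0)"
    moreover have "a = 0" if "b = 0"
      using eq that by simp
    ultimately have b: "b \<noteq> 0" by blast
    \<comment> \<open>A nontrivial zero of the determinant form would make \<open>a / b\<close> a
      forbidden solution.\<close>
    have "(a / b) * (a / b) + a / b = a * (a + b) / (b * b)"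
      using b by (simp add: add_divide_distrib distrib_left)
    also have "\<dots> = d"
      using b by (simp add: eq)
    finally show False using assms by blast
  qed
  then have "{(a, b). a * (a + b * 1) \<noteq> b * b * d} = UNIV - {(0, 0)}"
    by (intro Set.set_eqI) (simp add: split_beta prod_eq_iff, metis mult_zero_left)
  then show ?thesis
    by (simp add: card_companion_centralizer card_Diff_singleton power2_eq_square)
qed

text \<open>The map takes the value 0 at both 0 and -1, so on a finite field it is not surjective
  either. This works in every characteristic, including 2.\<close>

lemma ex_not_square_plus_self: "\<exists>d::'a::{field,finite}. \<forall>t. t * t + t \<noteq> d"
proof -
  have "\<not> inj (\<lambda>t::'a. t * t + t)"
  proof
    assume "inj (\<lambda>t::'a. t * t + t)"
    then have "0 = (- 1 :: 'a)" by (rule injD) simp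
    then show False by simp
  qed
  then have "\<not> surj (\<lambda>t::'a. t * t + t)"
    using finite_UNIV_surj_inj[of "\<lambda>t::'a. t * t + t"] by auto
  then obtain d :: 'a where "d \<notin> range (\<lambda>t. t * t + t)" by blast
  then have "\<forall>t. t * t + t \<noteq> d" by blast
  then show ?thesis ..
qed

section \<open>Gluing over the four centralizers\<close>

theorem theorem6p9:
  fixes q :: nat
  assumes "primepow q"
    and "CARD('a::{field,finite}) = q"
  shows "order (general_linear_group :: ('a ^ 2 ^ 2) monoid)
           dvd order (semicharacter_group (general_linear_group :: ('a ^ 2 ^ 2) monoid))"
proof -
  let ?G = "general_linear_group :: ('a ^ 2 ^ 2) monoid"
  interpret group ?G by (rule group_general_linear_group)
  obtain d :: 'a where d: "\<And>t. t * t + t \<noteq> d"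
    using ex_not_square_plus_self by blast
  have "d \<noteq> 0" using d[of 0] by auto
  have q: "q > 1"
    using assms(1) by (simp add: primepow_gt_Suc_0)
  define I :: "('a ^ 2 ^ 2) set" where
    "I = {mat2 0 0 0 1, mat2 0 0 1 1, mat2 0 0 1 0, mat2 0 d 1 1}"
  define Z :: "('a ^ 2 ^ 2) set" where "Z = {X \<in> scalar_mat2. invertible X}"
  \<comment> \<open>Writing \<open>Z\<close> as an intersection of two centralizers makes it a
    subgroup at once.\<close>
  have Z_centralizer: "Z = gl_centralizer (mat2 0 0 0 1) \<inter> gl_centralizer (mat2 0 0 1 0)"
  proof (rule Set.set_eqI)
    fix X :: "'a ^ 2 ^ 2"
    show "X \<in> Z \<longleftrightarrow> X \<in> gl_centralizer (mat2 0 0 0 1) \<inter> gl_centralizer (mat2 0 0 1 0)"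
      by (cases X) (auto simp: Z_def mat2_in_scalar_iff mat2_in_gl_centralizer_iff invertible_mat2)
  qed
  have "Z = (\<lambda>a. mat2 a 0 0 a) ` (UNIV - {0})"
    by (auto simp: Z_def scalar_mat2_def invertible_mat2)
  then have cardZ: "card Z = q - 1"
    by (simp add: card_image inj_on_def card_Diff_singleton assms(2))
  have "(\<Prod>M\<in>I. card (gl_centralizer M) div card Z) dvd order (semicharacter_group ?G)"
  proof (rule prod_index_dvd_order_semicharacter_group)
    show "subgroup Z ?G"
      unfolding Z_centralizer by (intro subgroups_Inter_pair subgroup_gl_centralizer)
    show "subgroup (gl_centralizer M) ?G" for M
      by (rule subgroup_gl_centralizer)
    show "Z \<subseteq> gl_centralizer M" for M
      using scalar_mat2_commute by (auto simp: Z_def gl_centralizer_def)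
    have I_nonscalar: "M \<notin> scalar_mat2" if "M \<in> I" for M
      using that \<open>d \<noteq> 0\<close> by (auto simp: I_def mat2_in_scalar_iff)
    show "X \<otimes>\<^bsub>?G\<^esub> Y = Y \<otimes>\<^bsub>?G\<^esub> X"
      if "M \<in> I" "X \<in> gl_centralizer M" "Y \<in> gl_centralizer M" for M X Y
      using mat2_commute_trans[OF I_nonscalar[OF that(1)]] that
      by (auto simp: gl_centralizer_def general_linear_group_def)
    show "Y \<in> gl_centralizer M"
      if "X \<in> gl_centralizer M - Z" "Y \<in> carrier ?G" "X \<otimes>\<^bsub>?G\<^esub> Y = Y \<otimes>\<^bsub>?G\<^esub> X" for M X Y
      \<comment> \<open>The invertible matrix \<open>X\<close> lies outside \<open>Z\<close>, so it
        is nonscalar and serves as the middle term between \<open>Y\<close> and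
        \<open>M\<close>.\<close>
      using mat2_commute_trans[of X Y M] that
      by (auto simp: gl_centralizer_def general_linear_group_def Z_def)
    show "gl_centralizer M \<inter> gl_centralizer N \<subseteq> Z" if "M \<in> I" "N \<in> I" "M \<noteq> N" for M N
    proof
      fix X assume X: "X \<in> gl_centralizer M \<inter> gl_centralizer N"
      \<comment> \<open>The vectors (0,0,1), (0,1,1), (0,1,0), (d,1,1) attached to the four matrices
        are pairwise not parallel as \<open>d\<close> is nonzero. A nonscalar \<open>X\<close>
        commuting with both \<open>M\<close> and \<open>N\<close> would force these two to
        commute.\<close>
      have "M ** N \<noteq> N ** M"
        using that \<open>d \<noteq> 0\<close> by (auto simp: I_def)
      then show "X \<in> Z"
        using mat2_commute_trans[of X M N] X by (auto simp: gl_centralizer_def Z_def)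
    qed
  qed (auto simp: I_def)
  also have "(\<Prod>M\<in>I. card (gl_centralizer M) div card Z) = (q - 1) * (q - 1) * q * (q + 1)"
  proof -
    have "(q - 1) ^ 2 div (q - 1) = q - 1" "q * (q - 1) div (q - 1) = q"
      using q by (auto simp: power2_eq_square)
    moreover have "q ^ 2 - 1 = (q + 1) * (q - 1)"
      by (simp add: power2_eq_square algebra_simps)
    then have "(q ^ 2 - 1) div (q - 1) = q + 1"
      using q by (metis nonzero_mult_div_cancel_right zero_less_diff less_numeral_extra(3))
    ultimately show ?thesis
      using \<open>d \<noteq> 0\<close> card_split_centralizers[where 'a = 'a] card_unipotent_centralizer[where 'a = 'a]
        card_nonsplit_centralizer[OF d]
      by (simp add: I_def cardZ assms(2) mult.assoc distrib_left)
  qed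
  also have "\<dots> = order ?G"
    by (simp add: order_GL2 assms(2) power2_eq_square)
  finally show ?thesis .
qed

end
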